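(* Assume that $\lambda_{\min}(\boldsymbol{G}(\boldsymbol{\xi}))\ge\omega_{\min}$ for all $\boldsymbol{\xi}\in\mathbb{X}$ for some $\omega_{\min}>0$, that $\mathbb{X}$ is convex and compact, that $\mathcal{K}$ is differentiable with respect to $\boldsymbol{\xi}\in\mathbb{X}$, that there is $\rho>0$ such that $\mathcal{K}^{\mathrm{red}}$ is directionally convex in $\Lambda_\psi^\star(\rho)$, and that $\nabla\mathcal{K}^{\mathrm{red}}$ is Lipschitz continuous with constant $L^{\mathrm{red}}>0$, i.e. $\|\nabla\mathcal{K}^{\mathrm{red}}(\boldsymbol{\xi})-\nabla\mathcal{K}^{\mathrm{red}}(\boldsymbol{\eta})\|_{\mathbb{X},*}\le L^{\mathrm{red}}\|\boldsymbol{\xi}-\boldsymbol{\eta}\|_{\mathbb{X}}$ for all $\boldsymbol{\xi},\boldsymbol{\eta}\in\mathbb{X}$. Let $\boldsymbol{\xi}_0\in\Lambda_\psi^\star(\rho)$, let $\zeta\in(0,1]$, and let $(\boldsymbol{\xi}_k)_{k\ge0}$ be the sequence produced by the alternating algorithm with exact updates of the linear parameters and constant step sizes $\gamma_k=\zeta\mu/L^{\mathrm{red}}$. Then for all $n\ge1$, $$\|\mathcal{R}^{\mathrm{red}}(\boldsymbol{\xi}_n)-u^\star\|_a^2\le\inf_{v\in V}\|v-u^\star\|_a^2+\frac{2L^{\mathrm{red}}\,\delta_\psi^\star(\boldsymbol{\xi}_0)}{\zeta\mu n}.$$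
   Context: Setting. $U$ is a real Hilbert space; $a:U\times U\to\mathbb{R}$ is a symmetric, continuous bilinear form with $a(u,u)\ge\alpha\|u\|_U^2$ for some $\alpha>0$; $\ell:U\to\mathbb{R}$ is a continuous linear form. The energy norm is $\|u\|_a=a(u,u)^{1/2}$, the energy is $\mathcal{J}(u)=\tfrac12a(u,u)-\ell(u)$, and $u^\star\in U$ is the unique solution of $a(u^\star,v)=\ell(v)$ for all $v\in U$. Let $\mathbb{W}=\mathbb{R}^{n_L}$ ($n_L\ge1$) and let $\mathbb{X}\subset\mathbb{R}^{n_{NL}}$ be closed and nonempty. Given basis functions $\boldsymbol{\phi}=(\boldsymbol{\phi}_1,\dots,\boldsymbol{\phi}_{n_L}):\mathbb{X}\to U^{n_L}$, put $\mathcal{R}(\boldsymbol{w},\boldsymbol{\xi})=\sum_k\boldsymbol{w}_k\boldsymbol{\phi}_k(\boldsymbol{\xi})$, $V=\mathcal{R}(\mathbb{W}\times\mathbb{X})\subset U$, and $\mathcal{K}(\boldsymbol{w},\boldsymbol{\xi})=\mathcal{J}(\mathcal{R}(\boldsymbol{w},\boldsymbol{\xi}))=\tfrac12\boldsymbol{w}^{*}\boldsymbol{A}(\boldsymbol{\xi})\boldsymbol{w}-\boldsymbol{w}^{*}\boldsymbol{\ell}(\boldsymbol{\xi})$, with $\boldsymbol{A}(\boldsymbol{\xi})_{ij}=a(\boldsymbol{\phi}_j(\boldsymbol{\xi}),\boldsymbol{\phi}_i(\boldsymbol{\xi}))$, $\boldsymbol{\ell}(\boldsymbol{\xi})_j=\ell(\boldsymbol{\phi}_j(\boldsymbol{\xi}))$.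 The Gram matrix is $\boldsymbol{G}(\boldsymbol{\xi})_{ij}=(\boldsymbol{\phi}_j(\boldsymbol{\xi}),\boldsymbol{\phi}_i(\boldsymbol{\xi}))_U$, and $\lambda_{\min}$ denotes the smallest eigenvalue. When $\lambda_{\min}(\boldsymbol{G}(\boldsymbol{\xi}))\ge\omega_{\min}>0$, $\boldsymbol{A}(\boldsymbol{\xi})$ is positive definite and one sets $\boldsymbol{w}^{\mathrm{best}}(\boldsymbol{\xi})=\boldsymbol{A}(\boldsymbol{\xi})^{-1}\boldsymbol{\ell}(\boldsymbol{\xi})$, the reduced realisation $\mathcal{R}^{\mathrm{red}}(\boldsymbol{\xi})=\mathcal{R}(\boldsymbol{w}^{\mathrm{best}}(\boldsymbol{\xi}),\boldsymbol{\xi})$ and the reduced energy $\mathcal{K}^{\mathrm{red}}(\boldsymbol{\xi})=\mathcal{K}(\boldsymbol{w}^{\mathrm{best}}(\boldsymbol{\xi}),\boldsymbol{\xi})$. Moreover $\mathcal{K}^\star=\min_{\mathbb{W}\times\mathbb{X}}\mathcal{K}=\min_{\mathbb{X}}\mathcal{K}^{\mathrm{red}}$. Norms and mirror map. $\|\cdot\|_{\mathbb{X}}$ is a norm on $\mathbb{R}^{n_{NL}}$ induced by an inner product, with dual norm $\|\cdot\|_{\mathbb{X},*}$ and duality pairing $\langle\cdot,\cdot\rangle_{\mathbb{X}}$. $\psi:\mathbb{X}\to\mathbb{R}$ is twice differentiable and $\mu$-strongly convex ($\mu>0$): $\psi(\boldsymbol{\eta})\ge\psi(\boldsymbol{\xi})+\langle\nabla\psi(\boldsymbol{\xi}),\boldsymbol{\eta}-\boldsymbol{\xi}\rangle_{\mathbb{X}}+\tfrac{\mu}{2}\|\boldsymbol{\eta}-\boldsymbol{\xi}\|_{\mathbb{X}}^2$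 for all $\boldsymbol{\xi},\boldsymbol{\eta}\in\mathbb{X}$. (Differentiability of functions on $\mathbb{X}$ is understood on an open neighbourhood of $\mathbb{X}$.) The Bregman divergence is $D_\psi(\boldsymbol{\eta};\boldsymbol{\xi})=\psi(\boldsymbol{\eta})-\psi(\boldsymbol{\xi})-\langle\nabla\psi(\boldsymbol{\xi}),\boldsymbol{\eta}-\boldsymbol{\xi}\rangle_{\mathbb{X}}$. Algorithm with exact linear updates. $\boldsymbol{w}_k=\boldsymbol{w}^{\mathrm{best}}(\boldsymbol{\xi}_k)$ for all $k\ge 0$, and $\boldsymbol{\xi}_{k+1}\in\arg\min_{\boldsymbol{\eta}\in\mathbb{X}}\ \gamma_k\langle\nabla_{\mathbb{X}}\mathcal{K}(\boldsymbol{w}_k,\boldsymbol{\xi}_k),\boldsymbol{\eta}\rangle_{\mathbb{X}}+D_\psi(\boldsymbol{\eta};\boldsymbol{\xi}_k)$, where $\nabla_{\mathbb{X}}$ is the gradient with respect to $\boldsymbol{\xi}$ at fixed $\boldsymbol{w}$ (no stopping test). Best nonlinear parameters. $\mathbb{X}^\star=\{\boldsymbol{\xi}\in\mathbb{X}:\mathcal{K}^{\mathrm{red}}(\boldsymbol{\xi})=\mathcal{K}^\star\}$; $\delta_\psi^\star(\boldsymbol{\xi})=\inf_{\boldsymbol{\xi}^\star\in\mathbb{X}^\star}D_\psi(\boldsymbol{\xi}^\star;\boldsymbol{\xi})$; $\Pi_\psi^\star(\boldsymbol{\xi})\subset\mathbb{X}^\star$ is the set of $\boldsymbol{\xi}^\star\in\mathbb{X}^\star$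 attaining this infimum; $\Lambda_\psi^\star(\rho)=\{\boldsymbol{\xi}\in\mathbb{X}:\delta_\psi^\star(\boldsymbol{\xi})\le\rho\}$. $\mathcal{K}^{\mathrm{red}}$ is directionally convex in $S\subset\mathbb{X}$ if for all $\boldsymbol{\xi}\in S$ there exists $\boldsymbol{\xi}^\star\in\Pi_\psi^\star(\boldsymbol{\xi})$ such that $\mathcal{K}^{\mathrm{red}}$ is convex on the segment $[\boldsymbol{\xi},\boldsymbol{\xi}^\star]$. *)

theory Defs
  imports "HOL-Analysis.Analysis"
begin

section \<open>Variational problem and parametrised trial set\<close>

definition energy_norm :: "('u \<Rightarrow> 'u \<Rightarrow> real) \<Rightarrow> 'u \<Rightarrow> real" where
  "energy_norm a u = sqrt (a u u)"

definition energy :: "('u \<Rightarrow> 'u \<Rightarrow> real) \<Rightarrow> ('u \<Rightarrow> real) \<Rightarrow> 'u \<Rightarrow> real" where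
  "energy a l u = 1/2 * a u u - l u"

text \<open>
  The basis functions are a total map \<open>\<phi>\<close>, of which only the values on (a neighbourhood of) the
  parameter set \<open>X\<close> matter; \<open>\<phi> \<xi> $ k\<close> is the \<open>k\<close>-th basis function at the nonlinear parameter \<open>\<xi>\<close>.
\<close>

definition realisation ::
  "('x \<Rightarrow> ('u::real_vector) ^ 'l) \<Rightarrow> real ^ 'l \<Rightarrow> 'x \<Rightarrow> 'u" where
  "realisation \<phi> w \<xi> = (\<Sum>k\<in>UNIV. (w $ k) *\<^sub>R (\<phi> \<xi> $ k))"

definition trial_set :: "('x \<Rightarrow> ('u::real_vector) ^ 'l) \<Rightarrow> 'x set \<Rightarrow> 'u set" where
  "trial_set \<phi> X = {realisation \<phi> w \<xi> | w \<xi>. \<xi> \<in> X}"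

definition param_energy ::
  "('u \<Rightarrow> 'u \<Rightarrow> real) \<Rightarrow> ('u \<Rightarrow> real) \<Rightarrow> ('x \<Rightarrow> ('u::real_vector) ^ 'l) \<Rightarrow> real ^ 'l \<Rightarrow> 'x \<Rightarrow> real" where
  "param_energy a l \<phi> w \<xi> = energy a l (realisation \<phi> w \<xi>)"

definition stiffness :: "('u \<Rightarrow> 'u \<Rightarrow> real) \<Rightarrow> ('x \<Rightarrow> 'u ^ 'l) \<Rightarrow> 'x \<Rightarrow> real ^ 'l ^ 'l" where
  "stiffness a \<phi> \<xi> = (\<chi> i j. a (\<phi> \<xi> $ j) (\<phi> \<xi> $ i))"

definition load :: "('u \<Rightarrow> real) \<Rightarrow> ('x \<Rightarrow> 'u ^ 'l) \<Rightarrow> 'x \<Rightarrow> real ^ 'l" where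
  "load l \<phi> \<xi> = (\<chi> j. l (\<phi> \<xi> $ j))"

definition gram :: "('x \<Rightarrow> ('u::real_inner) ^ 'l) \<Rightarrow> 'x \<Rightarrow> real ^ 'l ^ 'l" where
  "gram \<phi> \<xi> = (\<chi> i j. (\<phi> \<xi> $ j) \<bullet> (\<phi> \<xi> $ i))"

definition is_eigenvalue :: "real ^ 'n ^ 'n \<Rightarrow> real \<Rightarrow> bool" where
  "is_eigenvalue M c \<longleftrightarrow> (\<exists>v. v \<noteq> 0 \<and> M *v v = c *\<^sub>R v)"

text \<open>Only meaningful if \<open>M\<close> has a real eigenvalue, e.g. if \<open>M\<close> is symmetric.\<close>

definition lambda_min :: "real ^ 'n ^ 'n \<Rightarrow> real" where
  "lambda_min M = (LEAST c. is_eigenvalue M c)"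

definition w_best ::
  "('u \<Rightarrow> 'u \<Rightarrow> real) \<Rightarrow> ('u \<Rightarrow> real) \<Rightarrow> ('x \<Rightarrow> 'u ^ 'l) \<Rightarrow> 'x \<Rightarrow> real ^ 'l" where
  "w_best a l \<phi> \<xi> = matrix_inv (stiffness a \<phi> \<xi>) *v load l \<phi> \<xi>"

definition reduced_realisation ::
  "('u \<Rightarrow> 'u \<Rightarrow> real) \<Rightarrow> ('u \<Rightarrow> real) \<Rightarrow> ('x \<Rightarrow> ('u::real_vector) ^ 'l) \<Rightarrow> 'x \<Rightarrow> 'u" where
  "reduced_realisation a l \<phi> \<xi> = realisation \<phi> (w_best a l \<phi> \<xi>) \<xi>"

definition reduced_energy ::
  "('u \<Rightarrow> 'u \<Rightarrow> real) \<Rightarrow> ('u \<Rightarrow> real) \<Rightarrow> ('x \<Rightarrow> ('u::real_vector) ^ 'l) \<Rightarrow> 'x \<Rightarrow> real" where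
  "reduced_energy a l \<phi> \<xi> = param_energy a l \<phi> (w_best a l \<phi> \<xi>) \<xi>"

text \<open>
  The optimal value is written as an infimum; it is a minimum whenever the latter exists, in
  particular when \<open>X\<close> is compact and nonempty and the energy depends continuously on \<open>\<xi>\<close>, with
  Gram matrices uniformly positive definite.
\<close>

definition optimal_energy ::
  "('u \<Rightarrow> 'u \<Rightarrow> real) \<Rightarrow> ('u \<Rightarrow> real) \<Rightarrow> ('x \<Rightarrow> ('u::real_vector) ^ 'l) \<Rightarrow> 'x set \<Rightarrow> real" where
  "optimal_energy a l \<phi> X = (INF (w, \<xi>) \<in> UNIV \<times> X. param_energy a l \<phi> w \<xi>)"

section \<open>Norms, gradients and mirror map on the parameter space\<close>

definition is_inner_product :: "(real ^ 'n \<Rightarrow> real ^ 'n \<Rightarrow> real) \<Rightarrow> bool" where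
  "is_inner_product ip \<longleftrightarrow>
     bilinear ip \<and> (\<forall>x y. ip x y = ip y x) \<and> (\<forall>x. x \<noteq> 0 \<longrightarrow> 0 < ip x x)"

definition ip_norm :: "(real ^ 'n \<Rightarrow> real ^ 'n \<Rightarrow> real) \<Rightarrow> real ^ 'n \<Rightarrow> real" where
  "ip_norm ip x = sqrt (ip x x)"

text \<open>
  The dual of \<open>real ^ 'n\<close> is identified with \<open>real ^ 'n\<close> through the Euclidean pairing \<open>\<bullet>\<close> (not
  through \<open>ip\<close>), so that gradients are vectors of partial derivatives and \<open>\<bullet>\<close> is the duality pairing.
\<close>

definition ip_dual_norm :: "(real ^ 'n \<Rightarrow> real ^ 'n \<Rightarrow> real) \<Rightarrow> real ^ 'n \<Rightarrow> real" where
  "ip_dual_norm ip g = (SUP x \<in> {x. ip_norm ip x \<le> 1}. g \<bullet> x)"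

definition grad :: "(real ^ 'n \<Rightarrow> real) \<Rightarrow> real ^ 'n \<Rightarrow> real ^ 'n" where
  "grad f x = (THE g. GDERIV f x :> g)"

definition differentiable_around :: "(real ^ 'n \<Rightarrow> real) \<Rightarrow> (real ^ 'n) set \<Rightarrow> bool" where
  "differentiable_around f X \<longleftrightarrow> (\<exists>N. open N \<and> X \<subseteq> N \<and> f differentiable_on N)"

definition twice_differentiable_around :: "(real ^ 'n \<Rightarrow> real) \<Rightarrow> (real ^ 'n) set \<Rightarrow> bool" where
  "twice_differentiable_around f X \<longleftrightarrow>
     (\<exists>N. open N \<and> X \<subseteq> N \<and> f differentiable_on N \<and> grad f differentiable_on N)"

definition bregman :: "(real ^ 'n \<Rightarrow> real) \<Rightarrow> real ^ 'n \<Rightarrow> real ^ 'n \<Rightarrow> real" where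
  "bregman \<psi> \<eta> \<xi> = \<psi> \<eta> - \<psi> \<xi> - grad \<psi> \<xi> \<bullet> (\<eta> - \<xi>)"

definition strongly_convex_wrt ::
  "(real ^ 'n \<Rightarrow> real ^ 'n \<Rightarrow> real) \<Rightarrow> real \<Rightarrow> (real ^ 'n) set \<Rightarrow> (real ^ 'n \<Rightarrow> real) \<Rightarrow> bool" where
  "strongly_convex_wrt ip \<mu> X \<psi> \<longleftrightarrow>
     (\<forall>\<xi>\<in>X. \<forall>\<eta>\<in>X. \<psi> \<eta> \<ge> \<psi> \<xi> + grad \<psi> \<xi> \<bullet> (\<eta> - \<xi>) + \<mu> / 2 * (ip_norm ip (\<eta> - \<xi>))\<^sup>2)"

section \<open>Best nonlinear parameters\<close>

definition best_params ::
  "('u \<Rightarrow> 'u \<Rightarrow> real) \<Rightarrow> ('u \<Rightarrow> real) \<Rightarrow> ('x \<Rightarrow> ('u::real_vector) ^ 'l) \<Rightarrow> 'x set \<Rightarrow> 'x set" where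
  "best_params a l \<phi> X = {\<xi> \<in> X. reduced_energy a l \<phi> \<xi> = optimal_energy a l \<phi> X}"

text \<open>In the following, \<open>S\<close> stands for the set of best nonlinear parameters.\<close>

definition bregman_dist :: "(real ^ 'n \<Rightarrow> real) \<Rightarrow> (real ^ 'n) set \<Rightarrow> real ^ 'n \<Rightarrow> real" where
  "bregman_dist \<psi> S \<xi> = (INF \<eta> \<in> S. bregman \<psi> \<eta> \<xi>)"

definition bregman_proj :: "(real ^ 'n \<Rightarrow> real) \<Rightarrow> (real ^ 'n) set \<Rightarrow> real ^ 'n \<Rightarrow> (real ^ 'n) set" where
  "bregman_proj \<psi> S \<xi> = {\<eta> \<in> S. bregman \<psi> \<eta> \<xi> = bregman_dist \<psi> S \<xi>}"

definition bregman_sublevel ::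
  "(real ^ 'n \<Rightarrow> real) \<Rightarrow> (real ^ 'n) set \<Rightarrow> (real ^ 'n) set \<Rightarrow> real \<Rightarrow> (real ^ 'n) set" where
  "bregman_sublevel \<psi> S X \<rho> = {\<xi> \<in> X. bregman_dist \<psi> S \<xi> \<le> \<rho>}"

definition directionally_convex ::
  "(real ^ 'n \<Rightarrow> real) \<Rightarrow> (real ^ 'n) set \<Rightarrow> (real ^ 'n \<Rightarrow> real) \<Rightarrow> (real ^ 'n) set \<Rightarrow> bool" where
  "directionally_convex \<psi> S f T \<longleftrightarrow>
     (\<forall>\<xi>\<in>T. \<exists>\<eta>\<in>bregman_proj \<psi> S \<xi>. convex_on (closed_segment \<xi> \<eta>) f)"

section \<open>Alternating algorithm with exact linear updates\<close>

definition exact_alternating_run ::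
  "('u \<Rightarrow> 'u \<Rightarrow> real) \<Rightarrow> ('u \<Rightarrow> real) \<Rightarrow> (real ^ 'n \<Rightarrow> ('u::real_vector) ^ 'l) \<Rightarrow> (real ^ 'n) set \<Rightarrow>
   (real ^ 'n \<Rightarrow> real) \<Rightarrow> (nat \<Rightarrow> real) \<Rightarrow> (nat \<Rightarrow> real ^ 'l) \<Rightarrow> (nat \<Rightarrow> real ^ 'n) \<Rightarrow> bool" where
  "exact_alternating_run a l \<phi> X \<psi> \<gamma> w \<xi> \<longleftrightarrow>
     (\<forall>k. w k = w_best a l \<phi> (\<xi> k)) \<and>
     (\<forall>k. is_arg_min
        (\<lambda>\<eta>. \<gamma> k * (grad (param_energy a l \<phi> (w k)) (\<xi> k) \<bullet> \<eta>) + bregman \<psi> \<eta> (\<xi> k))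
        (\<lambda>\<eta>. \<eta> \<in> X) (\<xi> (Suc k)))"

end

theory Submission
  imports Defs
begin

text \<open>
  With exact linear updates the alternating algorithm is mirror descent for the reduced energy. The
  reduced energy at \<open>\<xi>\<close> is the minimum of the parametric energy over the linear parameters, so its
  gradient is the partial gradient of the parametric energy at the minimising weights
  (\<open>GDERIV_reduced_energy\<close>, an envelope theorem): the direction used by the algorithm is the exact
  gradient of the reduced energy, which is differentiable even though only the parametric energy was
  assumed to be.

  For mirror descent the step size \<open>\<gamma> = \<zeta> * \<mu> / L\<close> with \<open>\<zeta> \<le> 1\<close> is such that the quadratic remainder
  \<open>L / 2 * (ip_norm ip (\<eta> - \<xi>))\<^sup>2\<close> in the descent lemma is at most \<open>bregman \<psi> \<eta> \<xi> / \<gamma>\<close>, by strong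
  convexity of \<open>\<psi>\<close>. Together with the three-point inequality for Bregman proximal steps, and with
  the gradient inequality on the segment from the iterate to its Bregman projection onto the set of
  minimisers, this gives
  \<open>f (\<xi> (k+1)) - min f \<le> (\<delta> k - \<delta> (k+1)) / \<gamma>\<close>, where \<open>\<delta> k\<close> is the Bregman distance of \<open>\<xi> k\<close> to that
  set. Convexity towards the minimisers is available only on a sublevel set of the Bregman distance;
  the iterates never leave it, because the left-hand side is nonnegative and so \<open>\<delta>\<close> decreases. The
  right-hand side telescopes and the values \<open>f (\<xi> k)\<close> decrease, whence
  \<open>f (\<xi> n) - min f \<le> \<delta> 0 / (\<gamma> * n)\<close> (\<open>mirror_descent_rate\<close>).

  Energies become errors because \<open>energy_norm a (v - u)\<close> squared is twice the excess energy
  of \<open>v\<close> over the solution \<open>u\<close> (\<open>energy_norm_diff_solution\<close>).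
\<close>

section \<open>Gradients and directional inequalities\<close>

lemma GDERIV_unique:
  assumes "GDERIV f x :> d" "GDERIV f x :> e"
  shows "d = e"
proof -
  have "(\<lambda>h. h \<bullet> d) = (\<lambda>h. h \<bullet> e)"
    using assms unfolding gderiv_def by (rule has_derivative_unique)
  then show ?thesis
    by (simp only: fun_eq_iff vector_eq_ldot)
qed

lemma grad_eq: "grad f x = d" if "GDERIV f x :> d"
  unfolding grad_def
proof (rule the_equality)
  show "GDERIV f x :> d"
    by (rule that)
  show "e = d" if "GDERIV f x :> e" for e
    using that \<open>GDERIV f x :> d\<close> by (rule GDERIV_unique)
qed

lemma GDERIV_grad:
  fixes f :: "real ^ 'n \<Rightarrow> real"
  assumes "f differentiable (at x)"
  shows "GDERIV f x :> grad f x"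
proof -
  obtain f' where f': "(f has_derivative f') (at x)"
    using assms unfolding differentiable_def by blast
  then have "linear f'"
    by (rule has_derivative_linear)
  then have "f' = (\<lambda>h. h \<bullet> adjoint f' 1)"
    by (simp add: fun_eq_iff adjoint_works)
  with f' have "GDERIV f x :> adjoint f' 1"
    unfolding gderiv_def by simp
  then show ?thesis
    by (simp add: grad_eq)
qed

lemma differentiable_around_imp_differentiable_at:
  assumes "differentiable_around f X" "x \<in> X"
  shows "f differentiable (at x)"
  using assms unfolding differentiable_around_def
  by (meson differentiable_on_eq_differentiable_at in_mono)

lemma GDERIV_along_line:
  assumes "GDERIV f (x + t *\<^sub>R v) :> d"
  shows "((\<lambda>s. f (x + s *\<^sub>R v)) has_real_derivative v \<bullet> d) (at t)"
proof -
  have "((\<lambda>s. x + s *\<^sub>R v) has_derivative (\<lambda>s. s *\<^sub>R v)) (at t)"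
    by (auto intro!: derivative_eq_intros)
  from has_derivative_compose[OF this assms[unfolded gderiv_def]]
  show ?thesis
    by (simp add: has_field_derivative_def mult.commute[of _ "v \<bullet> d"])
qed

text \<open>
  A one-sided bound suffices because the derivative along \<open>v\<close> is the limit of the difference quotients
  for \<open>t\<close> decreasing to \<open>0\<close>. With \<open>c = 0\<close> this is the first-order optimality condition at a
  constrained minimum; applied to \<open>- f\<close> it is the gradient inequality of a convex function.
\<close>

lemma GDERIV_directional_lower_bound:
  assumes "GDERIV f x :> d" and "\<And>t. 0 < t \<Longrightarrow> t \<le> 1 \<Longrightarrow> t * c \<le> f (x + t *\<^sub>R v) - f x"
  shows "c \<le> d \<bullet> v"
proof -
  have "((\<lambda>s. f (x + s *\<^sub>R v)) has_real_derivative v \<bullet> d) (at 0)"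
    using assms(1) by (intro GDERIV_along_line) simp
  then have "((\<lambda>s. (f (x + s *\<^sub>R v) - f x) / s) \<longlongrightarrow> v \<bullet> d) (at 0)"
    by (simp add: has_field_derivative_iff)
  then have lim: "((\<lambda>s. (f (x + s *\<^sub>R v) - f x) / s) \<longlongrightarrow> v \<bullet> d) (at_right 0)"
    by (rule filterlim_mono) (simp_all add: at_le)
  have "eventually (\<lambda>s. s \<in> {0<..<1}) (at_right (0::real))"
    by (rule eventually_at_right_real) simp
  then have "eventually (\<lambda>s. c \<le> (f (x + s *\<^sub>R v) - f x) / s) (at_right 0)"
    by eventually_elim (use assms(2) in \<open>auto simp: field_simps\<close>)
  with lim have "c \<le> v \<bullet> d"
    by (intro tendsto_lowerbound[OF lim]) auto
  then show ?thesis
    by (simp add: inner_commute)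
qed

text \<open>
  Convexity is needed only on the one segment along which the difference quotients are taken, which
  is why directional convexity suffices later on.
\<close>

lemma convex_on_segment_gradient_le:
  assumes "GDERIV f x :> d" and "convex_on (closed_segment x y) f"
  shows "f x + d \<bullet> (y - x) \<le> f y"
proof -
  have "f x - f y \<le> - d \<bullet> (y - x)"
  proof (rule GDERIV_directional_lower_bound)
    show "GDERIV (\<lambda>z. - f z) x :> - d"
      using assms(1) by (rule GDERIV_minus)
    fix t :: real assume t: "0 < t" "t \<le> 1"
    have "f ((1 - t) *\<^sub>R x + t *\<^sub>R y) \<le> (1 - t) * f x + t * f y"
      using t by (intro convex_onD[OF assms(2)]) auto
    also have "(1 - t) *\<^sub>R x + t *\<^sub>R y = x + t *\<^sub>R (y - x)"
      by (simp add: algebra_simps)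
    finally show "t * (f x - f y) \<le> - f (x + t *\<^sub>R (y - x)) - - f x"
      by (simp add: algebra_simps)
  qed
  then show ?thesis
    by simp
qed

section \<open>Smoothness with respect to an inner product norm\<close>

text \<open>
  By homogeneity the best constant is the minimum of \<open>q\<close> on the unit sphere, attained by compactness
  and therefore positive.
\<close>

lemma positive_quadratic_lower_bound:
  fixes q :: "'a::euclidean_space \<Rightarrow> real"
  assumes cont: "continuous_on UNIV q" and hom: "\<And>c v. q (c *\<^sub>R v) = c\<^sup>2 * q v"
    and pos: "\<And>v. v \<noteq> 0 \<Longrightarrow> 0 < q v"
  obtains c where "0 < c" "\<And>v. c * (norm v)\<^sup>2 \<le> q v"
proof -
  obtain z where z: "z \<in> sphere 0 1" "\<And>v. v \<in> sphere 0 1 \<Longrightarrow> q z \<le> q v"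
    using continuous_attains_inf[of "sphere (0::'a) 1" q] continuous_on_subset[OF cont]
    by auto
  have "q z * (norm v)\<^sup>2 \<le> q v" for v
  proof (cases "v = 0")
    case True
    with hom[of 0 0] show ?thesis by simp
  next
    case False
    then have "q z \<le> q (inverse (norm v) *\<^sub>R v)"
      by (intro z(2)) simp
    with False show ?thesis
      by (simp add: hom field_simps)
  qed
  moreover have "0 < q z"
    using z(1) by (intro pos) auto
  ultimately show ?thesis
    using that by blast
qed

text \<open>
  The supremum in the dual norm is over a set on which linear forms are bounded, because the norm of
  the inner product dominates a multiple of the Euclidean one; scaling \<open>x\<close> into the unit ball then
  gives the inequality.
\<close>

lemma inner_le_ip_dual_norm:
  fixes g x :: "real ^ 'n"
  assumes ip: "is_inner_product ip"
  shows "g \<bullet> x \<le> ip_dual_norm ip g * ip_norm ip x"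
proof -
  have bil: "bilinear ip"
    using ip by (simp add: is_inner_product_def)
  interpret ip: bounded_bilinear ip
    using bil by (simp add: bilinear_conv_bounded_bilinear)
  have hom: "ip (c *\<^sub>R v) (c *\<^sub>R v) = c\<^sup>2 * ip v v" for c v
    by (simp add: ip.scaleR_left ip.scaleR_right power2_eq_square)
  have "continuous_on UNIV (\<lambda>v. ip v v)"
    by (intro ip.continuous_on continuous_intros)
  then obtain c where c: "0 < c" "\<And>v. c * (norm v)\<^sup>2 \<le> ip v v"
    using positive_quadratic_lower_bound[of "\<lambda>v. ip v v"] hom ip
    unfolding is_inner_product_def by metis
  have "norm y \<le> 1 / sqrt c" if "ip_norm ip y \<le> 1" for y
  proof -
    have "sqrt c * norm y = sqrt (c * (norm y)\<^sup>2)"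
      using c(1) by (simp add: real_sqrt_mult)
    also have "\<dots> \<le> 1"
      using c(2)[of y] that unfolding ip_norm_def
      by (meson order_trans real_sqrt_le_iff)
    finally show ?thesis
      using c(1) by (simp add: field_simps)
  qed
  then have "g \<bullet> y \<le> norm g * (1 / sqrt c)" if "ip_norm ip y \<le> 1" for y
    using that by (meson norm_cauchy_schwarz mult_left_mono norm_ge_zero order_trans)
  then have bdd: "bdd_above ((\<bullet>) g ` {y. ip_norm ip y \<le> 1})"
    by (intro bdd_aboveI2) blast
  show ?thesis
  proof (cases "x = 0")
    case True
    then show ?thesis by (simp add: ip_norm_def ip.zero_left)
  next
    case False
    define r where "r = ip_norm ip x"
    have r: "0 < r" "ip x x = r\<^sup>2"
      using ip False unfolding r_def ip_norm_def is_inner_product_def by (auto simp: less_imp_le)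
    then have "ip_norm ip (inverse r *\<^sub>R x) = 1"
      by (simp add: ip_norm_def hom power_inverse)
    then have "g \<bullet> (inverse r *\<^sub>R x) \<le> ip_dual_norm ip g"
      unfolding ip_dual_norm_def by (intro cSUP_upper[OF _ bdd]) simp
    then show ?thesis
      using r(1) by (simp add: r_def[symmetric] field_simps)
  qed
qed

text \<open>
  Along the segment from \<open>x\<close> to \<open>y\<close>, the difference of the two sides has derivative
  \<open>(grad f (x + t (y - x)) - grad f x) \<bullet> (y - x) - L * t * (ip_norm ip (y - x))\<^sup>2\<close>, which is at most \<open>0\<close>
  by the Lipschitz bound on the gradient, and it vanishes at \<open>x\<close>.
\<close>

lemma descent_lemma:
  fixes f :: "real ^ 'n \<Rightarrow> real"
  assumes ip: "is_inner_product ip" and "convex X"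
    and df: "\<And>x. x \<in> X \<Longrightarrow> GDERIV f x :> grad f x"
    and Lip: "\<And>x y. x \<in> X \<Longrightarrow> y \<in> X \<Longrightarrow>
      ip_dual_norm ip (grad f x - grad f y) \<le> L * ip_norm ip (x - y)"
    and x: "x \<in> X" and y: "y \<in> X"
  shows "f y \<le> f x + grad f x \<bullet> (y - x) + L / 2 * (ip_norm ip (y - x))\<^sup>2"
proof -
  interpret ip: bounded_bilinear ip
    using ip by (simp add: is_inner_product_def bilinear_conv_bounded_bilinear)
  define v where "v = y - x"
  define N where "N = ip_norm ip v"
  have N_nonneg: "0 \<le> N"
    using ip by (cases "v = 0") (auto simp: N_def ip_norm_def is_inner_product_def ip.zero_left less_imp_le)
  define h where "h t = f (x + t *\<^sub>R v) - t * (grad f x \<bullet> v) - L / 2 * t\<^sup>2 * N\<^sup>2" for t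
  have "h 1 \<le> h 0"
  proof (rule DERIV_nonpos_imp_nonincreasing[where f = h and a = 0 and b = 1])
    fix t :: real assume t: "0 \<le> t" "t \<le> 1"
    have "(1 - t) *\<^sub>R x + t *\<^sub>R y \<in> X"
      using t x y by (intro convexD_alt[OF \<open>convex X\<close>]) auto
    then have mem: "x + t *\<^sub>R v \<in> X"
      by (simp add: v_def algebra_simps)
    have norm_tv: "ip_norm ip (t *\<^sub>R v) = t * N"
      using t by (simp add: N_def ip_norm_def ip.scaleR_left ip.scaleR_right real_sqrt_mult
          flip: mult.assoc)
    have "(grad f (x + t *\<^sub>R v) - grad f x) \<bullet> v
      \<le> ip_dual_norm ip (grad f (x + t *\<^sub>R v) - grad f x) * N"
      unfolding N_def by (rule inner_le_ip_dual_norm[OF ip])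
    also have "\<dots> \<le> (L * ip_norm ip (x + t *\<^sub>R v - x)) * N"
      by (intro mult_right_mono Lip mem x N_nonneg)
    also have "\<dots> = L * t * N\<^sup>2"
      by (simp add: norm_tv power2_eq_square)
    finally have "v \<bullet> grad f (x + t *\<^sub>R v) - grad f x \<bullet> v - L * t * N\<^sup>2 \<le> 0"
      by (simp only: inner_diff_left inner_commute[of v "grad f (x + t *\<^sub>R v)"] diff_le_0_iff_le)
    moreover have "((\<lambda>s. f (x + s *\<^sub>R v)) has_real_derivative v \<bullet> grad f (x + t *\<^sub>R v)) (at t)"
      by (intro GDERIV_along_line df mem)
    then have "(h has_real_derivative
        v \<bullet> grad f (x + t *\<^sub>R v) - grad f x \<bullet> v - L * t * N\<^sup>2) (at t)"
      unfolding h_def by (auto intro!: derivative_eq_intros)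
    ultimately show "\<exists>d. (h has_real_derivative d) (at t) \<and> d \<le> 0"
      by blast
  qed simp
  then show ?thesis
    by (simp add: h_def v_def N_def)
qed

section \<open>Mirror descent under directional convexity\<close>

text \<open>
  The objective of the step has gradient \<open>g + grad \<psi> z - grad \<psi> x\<close> at its minimiser \<open>z\<close>. The inequality
  is the first-order optimality condition at \<open>z\<close> in the direction \<open>y - z\<close>, rewritten by expanding the
  three divergences.
\<close>

lemma bregman_three_point:
  fixes \<psi> :: "real ^ 'n \<Rightarrow> real"
  assumes "convex X" and d\<psi>: "GDERIV \<psi> z :> grad \<psi> z"
    and min: "is_arg_min (\<lambda>\<eta>. g \<bullet> \<eta> + bregman \<psi> \<eta> x) (\<lambda>\<eta>. \<eta> \<in> X) z"
    and y: "y \<in> X"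
  shows "g \<bullet> z + bregman \<psi> z x + bregman \<psi> y z \<le> g \<bullet> y + bregman \<psi> y x"
proof -
  define F where "F \<eta> = g \<bullet> \<eta> + bregman \<psi> \<eta> x" for \<eta>
  have z: "z \<in> X" and le: "\<And>\<eta>. \<eta> \<in> X \<Longrightarrow> F z \<le> F \<eta>"
    using min by (auto simp: is_arg_min_linorder F_def)
  have "0 \<le> (g + grad \<psi> z - grad \<psi> x) \<bullet> (y - z)"
  proof (rule GDERIV_directional_lower_bound[where f = F])
    show "GDERIV F z :> g + grad \<psi> z - grad \<psi> x"
      using d\<psi> unfolding gderiv_def F_def bregman_def
      by (auto intro!: derivative_eq_intros simp: inner_simps inner_commute)
    fix t :: real assume t: "0 < t" "t \<le> 1"
    have "(1 - t) *\<^sub>R z + t *\<^sub>R y \<in> X"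
      using t z y by (intro convexD_alt[OF \<open>convex X\<close>]) auto
    then have "F z \<le> F (z + t *\<^sub>R (y - z))"
      by (intro le) (simp add: algebra_simps)
    then show "t * 0 \<le> F (z + t *\<^sub>R (y - z)) - F z"
      by simp
  qed
  then show ?thesis
    by (simp add: bregman_def inner_simps)
qed

text \<open>
  Smoothness of \<open>f\<close> is required relative to \<open>\<psi>\<close>, with constant \<open>1 / \<gamma>\<close>, instead of with respect to a
  norm: the remainder then cancels exactly the divergence \<open>bregman \<psi> (\<xi> (k+1)) (\<xi> k)\<close> that the
  three-point inequality provides.
\<close>

lemma mirror_descent_rate:
  fixes f \<psi> :: "real ^ 'n \<Rightarrow> real" and \<xi> :: "nat \<Rightarrow> real ^ 'n"
  assumes "convex X" "S \<subseteq> X"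
    and opt: "\<And>x. x \<in> S \<Longrightarrow> f x = m" "\<And>x. x \<in> X \<Longrightarrow> m \<le> f x"
    and df: "\<And>x. x \<in> X \<Longrightarrow> GDERIV f x :> grad f x"
    and d\<psi>: "\<And>x. x \<in> X \<Longrightarrow> GDERIV \<psi> x :> grad \<psi> x"
    and nonneg: "\<And>x y. x \<in> X \<Longrightarrow> y \<in> X \<Longrightarrow> 0 \<le> bregman \<psi> y x"
    and \<gamma>: "0 < \<gamma>"
    and smooth: "\<And>x y. x \<in> X \<Longrightarrow> y \<in> X \<Longrightarrow>
      f y \<le> f x + grad f x \<bullet> (y - x) + bregman \<psi> y x / \<gamma>"
    and dir: "directionally_convex \<psi> S f (bregman_sublevel \<psi> S X \<rho>)"
    and init: "\<xi> 0 \<in> bregman_sublevel \<psi> S X \<rho>"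
    and step: "\<And>k. is_arg_min (\<lambda>\<eta>. \<gamma> * (grad f (\<xi> k) \<bullet> \<eta>) + bregman \<psi> \<eta> (\<xi> k))
      (\<lambda>\<eta>. \<eta> \<in> X) (\<xi> (Suc k))"
    and "1 \<le> n"
  shows "f (\<xi> n) - m \<le> bregman_dist \<psi> S (\<xi> 0) / (\<gamma> * real n)"
proof -
  define \<delta> where "\<delta> k = bregman_dist \<psi> S (\<xi> k)" for k
  have mem: "\<xi> k \<in> X" for k
    using init step by (cases k) (auto simp: bregman_sublevel_def is_arg_min_def)
  have bdd: "bdd_below ((\<lambda>\<eta>. bregman \<psi> \<eta> x) ` S)" if "x \<in> X" for x
    using nonneg that \<open>S \<subseteq> X\<close> by (intro bdd_belowI2[where m = 0]) auto
  \<comment> \<open>Holds for every comparison point: the current iterate gives monotonicity of the values, its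
    Bregman projection onto \<open>S\<close> gives the decay of the distance.\<close>
  have progress: "f (\<xi> (Suc k)) \<le> f (\<xi> k) + grad f (\<xi> k) \<bullet> (y - \<xi> k)
      + (bregman \<psi> y (\<xi> k) - bregman \<psi> y (\<xi> (Suc k))) / \<gamma>" if "y \<in> X" for k y
  proof -
    have "\<gamma> * (grad f (\<xi> k) \<bullet> \<xi> (Suc k)) + bregman \<psi> (\<xi> (Suc k)) (\<xi> k) + bregman \<psi> y (\<xi> (Suc k))
      \<le> \<gamma> * (grad f (\<xi> k) \<bullet> y) + bregman \<psi> y (\<xi> k)"
      using bregman_three_point[OF \<open>convex X\<close> d\<psi>[OF mem], of "\<gamma> *\<^sub>R grad f (\<xi> k)"] step that by simp
    with smooth[OF mem[of k] mem[of "Suc k"]] \<gamma> show ?thesis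
      by (simp add: inner_simps field_simps)
  qed
  have gap: "f (\<xi> (Suc k)) - m \<le> (\<delta> k - \<delta> (Suc k)) / \<gamma>" if "\<delta> k \<le> \<rho>" for k
  proof -
    have "\<xi> k \<in> bregman_sublevel \<psi> S X \<rho>"
      using that mem by (simp add: bregman_sublevel_def \<delta>_def)
    with dir obtain y where y: "y \<in> S" "bregman \<psi> y (\<xi> k) = \<delta> k"
      and conv: "convex_on (closed_segment (\<xi> k) y) f"
      unfolding directionally_convex_def bregman_proj_def \<delta>_def by blast
    have "f (\<xi> k) + grad f (\<xi> k) \<bullet> (y - \<xi> k) \<le> m"
      using convex_on_segment_gradient_le[OF df[OF mem] conv] opt(1)[OF y(1)] by simp
    moreover have "\<delta> (Suc k) \<le> bregman \<psi> y (\<xi> (Suc k))"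
      unfolding \<delta>_def bregman_dist_def by (intro cINF_lower bdd mem y(1))
    moreover have "f (\<xi> (Suc k)) \<le> f (\<xi> k) + grad f (\<xi> k) \<bullet> (y - \<xi> k)
      + (\<delta> k - bregman \<psi> y (\<xi> (Suc k))) / \<gamma>"
      using progress[of y k] y \<open>S \<subseteq> X\<close> by auto
    ultimately show ?thesis
      using divide_right_mono[of "\<delta> k - bregman \<psi> y (\<xi> (Suc k))" "\<delta> k - \<delta> (Suc k)" \<gamma>] \<gamma> by linarith
  qed
  have decreasing: "f (\<xi> (Suc k)) \<le> f (\<xi> k)" for k
  proof -
    have "0 \<le> bregman \<psi> (\<xi> k) (\<xi> (Suc k))"
      by (intro nonneg mem)
    moreover have "bregman \<psi> (\<xi> k) (\<xi> k) = 0"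
      by (simp add: bregman_def)
    ultimately show ?thesis
      using progress[OF mem, of k k] divide_nonneg_pos[OF _ \<gamma>, of "bregman \<psi> (\<xi> k) (\<xi> (Suc k))"]
      by simp
  qed
  \<comment> \<open>\<open>gap\<close> needs the iterate to lie in the sublevel set, and yields in turn that the next one does.\<close>
  have stay: "\<delta> k \<le> \<rho>" for k
  proof (induction k)
    case 0
    then show ?case using init by (simp add: \<delta>_def bregman_sublevel_def)
  next
    case (Suc k)
    have "0 \<le> (\<delta> k - \<delta> (Suc k)) / \<gamma>"
      using gap[OF Suc] opt(2)[OF mem[of "Suc k"]] by linarith
    with \<gamma> Suc show ?case
      by (simp add: zero_le_divide_iff)
  qed
  have "real k * (f (\<xi> k) - m) \<le> (\<delta> 0 - \<delta> k) / \<gamma>" for k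
  proof (induction k)
    case (Suc k)
    have "real k * (f (\<xi> (Suc k)) - m) \<le> real k * (f (\<xi> k) - m)"
      using decreasing[of k] by (intro mult_left_mono) auto
    with Suc gap[OF stay, of k] show ?case
      by (simp add: algebra_simps diff_divide_distrib)
  qed simp
  also have "(\<delta> 0 - \<delta> n) / \<gamma> \<le> \<delta> 0 / \<gamma>"
  proof -
    have "S \<noteq> {}"
      using dir init by (auto simp: directionally_convex_def bregman_proj_def)
    then have "0 \<le> \<delta> n"
      unfolding \<delta>_def bregman_dist_def using \<open>S \<subseteq> X\<close> mem nonneg by (intro cINF_greatest) auto
    with \<gamma> show ?thesis
      by (simp add: divide_right_mono)
  qed
  finally show ?thesis
    using \<open>1 \<le> n\<close> \<gamma> by (simp add: \<delta>_def field_simps)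
qed

section \<open>Reduced energy of a coercive variational problem\<close>

text \<open>
  Uniform positive definiteness is an open condition: a perturbation of \<open>M\<close> of operator norm at most
  half its coercivity constant leaves half of that constant. It provides control of the stiffness
  matrix at parameters near \<open>X\<close>, where the Gram matrix is not known to be nondegenerate.
\<close>

lemma positive_definite_eventually:
  fixes A :: "'a \<Rightarrow> real ^ 'l ^ 'l"
  assumes lim: "(A \<longlongrightarrow> M) F" and pos: "\<And>v. v \<noteq> 0 \<Longrightarrow> 0 < v \<bullet> (M *v v)"
  obtains c where "0 < c" "\<forall>\<^sub>F \<xi> in F. \<forall>v. c * (norm v)\<^sup>2 \<le> v \<bullet> (A \<xi> *v v)"
proof -
  have "continuous_on UNIV (\<lambda>v. v \<bullet> (M *v v))"
    by (intro continuous_intros)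
  moreover have "(r *\<^sub>R v) \<bullet> (M *v (r *\<^sub>R v)) = r\<^sup>2 * (v \<bullet> (M *v v))" for r v
    by (simp add: matrix_vector_mult_scaleR power2_eq_square)
  ultimately obtain c where c: "0 < c" "\<And>v. c * (norm v)\<^sup>2 \<le> v \<bullet> (M *v v)"
    using positive_quadratic_lower_bound[of "\<lambda>v. v \<bullet> (M *v v)"] pos by blast
  \<comment> \<open>The operator norm is bounded through the entries, which costs the factor \<open>CARD('l) * CARD('l)\<close>.\<close>
  define B where "B = c / (2 * (real CARD('l) * real CARD('l)))"
  have "0 < B"
    using c(1) by (simp add: B_def)
  with lim have "\<forall>\<^sub>F \<xi> in F. dist (A \<xi>) M < B"
    by (rule tendstoD)
  then have "\<forall>\<^sub>F \<xi> in F. \<forall>v. c / 2 * (norm v)\<^sup>2 \<le> v \<bullet> (A \<xi> *v v)"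
  proof (eventually_elim, intro allI)
    fix \<xi> v assume near: "dist (A \<xi>) M < B"
    have "\<bar>(M - A \<xi>) $ i $ j\<bar> \<le> B" for i j
    proof -
      have "\<bar>(M - A \<xi>) $ i $ j\<bar> \<le> norm ((M - A \<xi>) $ i)"
        by (rule component_le_norm_cart)
      also have "\<dots> \<le> norm (M - A \<xi>)"
        by (rule Finite_Cartesian_Product.norm_nth_le)
      finally show ?thesis
        using near by (simp add: dist_norm norm_minus_commute)
    qed
    then have "onorm ((*v) (M - A \<xi>)) \<le> real CARD('l) * real CARD('l) * B"
      by (rule onorm_le_matrix_component)
    then have on: "onorm ((*v) (M - A \<xi>)) \<le> c / 2"
      by (simp add: B_def)
    have "v \<bullet> ((M - A \<xi>) *v v) \<le> norm v * norm ((M - A \<xi>) *v v)"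
      by (rule norm_cauchy_schwarz)
    also have "\<dots> \<le> norm v * (c / 2 * norm v)"
      by (intro mult_left_mono order_trans[OF onorm[OF matrix_vector_mul_bounded_linear]]
          mult_right_mono on) auto
    finally show "c / 2 * (norm v)\<^sup>2 \<le> v \<bullet> (A \<xi> *v v)"
      using c(2)[of v]
      by (simp add: matrix_vector_mult_diff_rdistrib inner_diff_right power2_eq_square algebra_simps)
  qed
  with c(1) show ?thesis
    by (intro that[of "c / 2"]) auto
qed

lemma realisation_add: "realisation \<phi> (v + w) \<xi> = realisation \<phi> v \<xi> + realisation \<phi> w \<xi>"
  by (simp add: realisation_def algebra_simps sum.distrib)

lemma realisation_axis: "realisation \<phi> (axis k 1) \<xi> = \<phi> \<xi> $ k"
  by (simp add: realisation_def axis_def if_distrib[of "\<lambda>c. c *\<^sub>R _"] cong: if_cong)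

lemma gram_mult_nth: "(gram \<phi> \<xi> *v v) $ i = realisation \<phi> v \<xi> \<bullet> (\<phi> \<xi> $ i)"
  by (simp add: gram_def matrix_vector_mult_def realisation_def inner_sum_left mult.commute)

lemma inner_gram: "v \<bullet> (gram \<phi> \<xi> *v v) = (norm (realisation \<phi> v \<xi>))\<^sup>2"
proof -
  have "v \<bullet> (gram \<phi> \<xi> *v v) = (\<Sum>i\<in>UNIV. v $ i * (realisation \<phi> v \<xi> \<bullet> (\<phi> \<xi> $ i)))"
    by (simp add: inner_vec_def gram_mult_nth)
  also have "\<dots> = realisation \<phi> v \<xi> \<bullet> realisation \<phi> v \<xi>"
    by (subst (3) realisation_def) (simp add: inner_sum_right)
  finally show ?thesis
    by (simp add: power2_norm_eq_inner)
qed

text \<open>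
  The eigenvalues of the Gram matrix are nonnegative, since its quadratic form is the squared norm of
  the realisation. A nonzero \<open>v\<close> with vanishing realisation would be an eigenvector for \<open>0\<close>, which
  would then be the smallest eigenvalue.
\<close>

lemma realisation_eq_0_iff:
  assumes "0 < lambda_min (gram \<phi> \<xi>)"
  shows "realisation \<phi> v \<xi> = 0 \<longleftrightarrow> v = 0"
proof
  assume R: "realisation \<phi> v \<xi> = 0"
  show "v = 0"
  proof (rule ccontr)
    assume "v \<noteq> 0"
    moreover have "gram \<phi> \<xi> *v v = 0 *\<^sub>R v"
      by (simp add: vec_eq_iff gram_mult_nth R)
    ultimately have "is_eigenvalue (gram \<phi> \<xi>) 0"
      unfolding is_eigenvalue_def by blast
    moreover have "0 \<le> c" if "is_eigenvalue (gram \<phi> \<xi>) c" for c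
    proof -
      obtain u where u: "u \<noteq> 0" "gram \<phi> \<xi> *v u = c *\<^sub>R u"
        using \<open>is_eigenvalue (gram \<phi> \<xi>) c\<close> unfolding is_eigenvalue_def by blast
      then have "c * (u \<bullet> u) = (norm (realisation \<phi> u \<xi>))\<^sup>2"
        by (simp flip: inner_gram)
      then have "0 \<le> c * (u \<bullet> u)"
        by simp
      moreover have "0 < u \<bullet> u"
        using u(1) by simp
      ultimately show ?thesis
        by (simp only: zero_le_mult_iff) linarith
    qed
    ultimately have "lambda_min (gram \<phi> \<xi>) = 0"
      unfolding lambda_min_def by (rule Least_equality)
    with assms show False by simp
  qed
qed (simp add: realisation_def)

locale ritz_problem = bounded_bilinear a
  for a :: "'u::real_inner \<Rightarrow> 'u \<Rightarrow> real" +
  fixes l :: "'u \<Rightarrow> real" and \<alpha> :: real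
  assumes sym: "a u v = a v u"
    and coercive: "0 < \<alpha>" "\<alpha> * (norm u)\<^sup>2 \<le> a u u"
    and linear_l: "bounded_linear l"
begin

interpretation l: bounded_linear l
  by (rule linear_l)

lemma form_realisation: "a (realisation \<phi> v \<xi>) (realisation \<phi> w \<xi>) = w \<bullet> (stiffness a \<phi> \<xi> *v v)"
  by (simp add: realisation_def stiffness_def matrix_vector_mult_def inner_vec_def
      sum_left sum_right scaleR_left scaleR_right sum_distrib_left mult_ac)

lemma load_realisation: "l (realisation \<phi> v \<xi>) = v \<bullet> load l \<phi> \<xi>"
  by (simp add: realisation_def load_def inner_vec_def l.sum l.scaleR)

lemma energy_add: "energy a l (u + v) = energy a l u + (a u v - l v) + a v v / 2"
  by (simp add: energy_def add_left add_right l.add sym[of v u])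

text \<open>
  At the solution the linear term in \<open>energy_add\<close> vanishes.
\<close>

lemma energy_norm_diff_solution:
  assumes "\<And>v. a s v = l v"
  shows "(energy_norm a (v - s))\<^sup>2 = 2 * (energy a l v - energy a l s)"
proof -
  have "0 \<le> a (v - s) (v - s)"
    by (rule order_trans[OF _ coercive(2)]) (use coercive(1) in simp)
  moreover have "energy a l v = energy a l s + a (v - s) (v - s) / 2"
    using energy_add[of s "v - s"] assms by simp
  ultimately show ?thesis
    by (simp add: energy_norm_def)
qed

lemma stiffness_positive:
  assumes "0 < lambda_min (gram \<phi> \<xi>)" "v \<noteq> 0"
  shows "0 < v \<bullet> (stiffness a \<phi> \<xi> *v v)"
proof -
  have "0 < \<alpha> * (norm (realisation \<phi> v \<xi>))\<^sup>2"
    using assms coercive(1) by (simp add: realisation_eq_0_iff)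
  also have "\<dots> \<le> v \<bullet> (stiffness a \<phi> \<xi> *v v)"
    using coercive(2) by (simp flip: form_realisation)
  finally show ?thesis .
qed

lemma stiffness_w_best:
  assumes "\<And>v. v \<noteq> 0 \<Longrightarrow> 0 < v \<bullet> (stiffness a \<phi> \<xi> *v v)"
  shows "stiffness a \<phi> \<xi> *v w_best a l \<phi> \<xi> = load l \<phi> \<xi>"
proof -
  have "v = 0" if "stiffness a \<phi> \<xi> *v v = 0" for v
    using assms[of v] that by fastforce
  then have "invertible (stiffness a \<phi> \<xi>)"
    using matrix_left_invertible_ker invertible_left_inverse by blast
  then have "stiffness a \<phi> \<xi> ** matrix_inv (stiffness a \<phi> \<xi>) = mat 1"
    unfolding invertible_def matrix_inv_def by (rule someI_ex[THEN conjunct1])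
  then show ?thesis
    by (simp add: w_best_def matrix_vector_mul_assoc)
qed

lemma param_energy_add:
  "param_energy a l \<phi> (u + v) \<xi> = param_energy a l \<phi> u \<xi>
    + v \<bullet> (stiffness a \<phi> \<xi> *v u - load l \<phi> \<xi>) + v \<bullet> (stiffness a \<phi> \<xi> *v v) / 2"
  by (simp add: param_energy_def realisation_add energy_add form_realisation load_realisation
      inner_diff_right)

lemma reduced_energy_le:
  assumes "\<And>v. v \<noteq> 0 \<Longrightarrow> 0 < v \<bullet> (stiffness a \<phi> \<xi> *v v)"
  shows "reduced_energy a l \<phi> \<xi> \<le> param_energy a l \<phi> v \<xi>"
proof -
  let ?d = "v - w_best a l \<phi> \<xi>"
  have "param_energy a l \<phi> v \<xi> = reduced_energy a l \<phi> \<xi> + ?d \<bullet> (stiffness a \<phi> \<xi> *v ?d) / 2"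
    using param_energy_add[of \<phi> "w_best a l \<phi> \<xi>" ?d \<xi>] stiffness_w_best[OF assms]
    by (simp add: reduced_energy_def)
  moreover have "0 \<le> ?d \<bullet> (stiffness a \<phi> \<xi> *v ?d)"
    using assms[of ?d] by (cases "?d = 0") auto
  ultimately show ?thesis
    by linarith
qed

text \<open>
  Envelope theorem. Let \<open>w0\<close> be the best weights at \<open>x\<close>, and let \<open>r\<close> be the residual at other parameters
  of the linear system for the best weights, evaluated at \<open>w0\<close>. Freezing the weights at \<open>w0\<close> overestimates
  the reduced energy, by at most \<open>(norm (r \<xi>))\<^sup>2 / (2 * c)\<close> for \<open>c\<close> a coercivity constant of the stiffness
  matrices near \<open>x\<close>. The residual vanishes at \<open>x\<close> and is differentiable there, so the bound, and with
  it the overestimate, has derivative \<open>0\<close> at \<open>x\<close>. This avoids differentiating the inverse of the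
  stiffness matrix.
\<close>

lemma GDERIV_reduced_energy:
  fixes \<phi> :: "real ^ 'n \<Rightarrow> 'u ^ 'l"
  assumes diff: "\<And>v. param_energy a l \<phi> v differentiable (at x)"
    and pos: "\<And>v. v \<noteq> 0 \<Longrightarrow> 0 < v \<bullet> (stiffness a \<phi> x *v v)"
  shows "GDERIV (reduced_energy a l \<phi>) x :> grad (param_energy a l \<phi> (w_best a l \<phi> x)) x"
proof -
  define K where "K = param_energy a l \<phi>"
  define A where "A = stiffness a \<phi>"
  define w0 where "w0 = w_best a l \<phi> x"
  define r where "r \<xi> = A \<xi> *v w0 - load l \<phi> \<xi>" for \<xi>
  have r0: "r x = 0"
    using stiffness_w_best[OF pos] by (simp add: r_def A_def w0_def)
  have K_add: "K (u + v) \<xi> = K u \<xi> + v \<bullet> (A \<xi> *v u - load l \<phi> \<xi>) + v \<bullet> (A \<xi> *v v) / 2" for u v \<xi>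
    unfolding K_def A_def by (rule param_energy_add)
  \<comment> \<open>Polarisation recovers the entries of the matrix, and below those of the residual, from finitely many
    parametric energies, which is how continuity and differentiability reach them.\<close>
  have entry: "A \<xi> $ i $ j = K (axis j 1 + axis i 1) \<xi> - K (axis j 1) \<xi> - K (axis i 1) \<xi>" for \<xi> i j
    by (simp add: K_def param_energy_def realisation_add energy_add realisation_axis A_def
        stiffness_def) (simp add: energy_def)
  have lim: "(A \<longlongrightarrow> A x) (at x)"
  proof (intro vec_tendstoI)
    fix i j
    have "isCont (K v) x" for v
      using diff[of v] unfolding K_def by (rule differentiable_imp_continuous_within)
    then show "((\<lambda>\<xi>. A \<xi> $ i $ j) \<longlongrightarrow> A x $ i $ j) (at x)"
      unfolding entry by (intro tendsto_intros) (simp_all add: isCont_def)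
  qed
  obtain c where c: "0 < c" and ev: "\<forall>\<^sub>F \<xi> in at x. \<forall>v. c * (norm v)\<^sup>2 \<le> v \<bullet> (A \<xi> *v v)"
    by (rule positive_definite_eventually[OF lim]) (use pos in \<open>auto simp: A_def\<close>)
  define p where "p \<xi> = (\<Sum>k\<in>UNIV. (r \<xi> $ k)\<^sup>2) / (2 * c)" for \<xi>
  have p_eq: "p \<xi> = (norm (r \<xi>))\<^sup>2 / (2 * c)" for \<xi>
    unfolding p_def power2_norm_eq_inner by (simp add: inner_vec_def power2_eq_square)
  have "((\<lambda>\<xi>. r \<xi> $ k) has_derivative (\<lambda>h. h \<bullet> grad (\<lambda>\<xi>. r \<xi> $ k) x)) (at x)" for k
  proof -
    have r_k: "r \<xi> $ k = (K (w0 + axis k 1) \<xi> - K (w0 + - axis k 1) \<xi>) * (1 / 2)" for \<xi>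
    proof -
      have "A \<xi> *v (- axis k 1) = - (A \<xi> *v axis k 1)"
        by (rule linear_neg[OF matrix_vector_mul_linear])
      then show ?thesis
        using K_add[of w0 "axis k 1" \<xi>] K_add[of w0 "- axis k 1" \<xi>]
        by (simp add: inner_axis' flip: r_def)
    qed
    have "(\<lambda>\<xi>. r \<xi> $ k) differentiable (at x)"
      unfolding r_k K_def by (intro differentiable_mult differentiable_diff differentiable_const diff)
    then show ?thesis
      by (rule GDERIV_grad[unfolded gderiv_def])
  qed
  then have p': "(p has_derivative (\<lambda>_. 0)) (at x)"
    unfolding p_def using r0 c by (auto intro!: derivative_eq_intros)
  define h where "h \<xi> = K w0 \<xi> - reduced_energy a l \<phi> \<xi>" for \<xi>
  \<comment> \<open>The upper bound minimises the quadratic \<open>v \<bullet> r \<xi> + c / 2 * (norm v)\<^sup>2\<close> over \<open>v\<close> by completing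
    the square.\<close>
  have gap: "0 \<le> h \<xi> \<and> h \<xi> \<le> p \<xi>" if low: "\<forall>v. c * (norm v)\<^sup>2 \<le> v \<bullet> (A \<xi> *v v)" for \<xi>
  proof
    have "0 < v \<bullet> (A \<xi> *v v)" if "v \<noteq> 0" for v
      using low[rule_format, of v] that c by (smt (verit) mult_pos_pos zero_less_norm_iff zero_less_power)
    then show "0 \<le> h \<xi>"
      using reduced_energy_le[of \<phi> \<xi> w0] by (simp add: h_def K_def A_def)
    define v where "v = w_best a l \<phi> \<xi> - w0"
    have "(norm (r \<xi> + c *\<^sub>R v))\<^sup>2 = (norm (r \<xi>))\<^sup>2 + 2 * c * (v \<bullet> r \<xi>) + c * (c * (norm v)\<^sup>2)"
      unfolding power2_norm_eq_inner by (simp add: inner_simps inner_commute[of v "r \<xi>"] algebra_simps)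
    then have "(norm (r \<xi> + c *\<^sub>R v))\<^sup>2 / (2 * c) = p \<xi> + v \<bullet> r \<xi> + c * (norm v)\<^sup>2 / 2"
      unfolding p_eq using c by (simp add: add_divide_distrib)
    moreover have "0 \<le> (norm (r \<xi> + c *\<^sub>R v))\<^sup>2 / (2 * c)"
      using c by simp
    ultimately have "0 \<le> p \<xi> + v \<bullet> r \<xi> + c * (norm v)\<^sup>2 / 2"
      by (simp only:)
    moreover have "c * (norm v)\<^sup>2 \<le> v \<bullet> (A \<xi> *v v)"
      using low by blast
    moreover have "reduced_energy a l \<phi> \<xi> = K w0 \<xi> + v \<bullet> r \<xi> + v \<bullet> (A \<xi> *v v) / 2"
      using K_add[of w0 v] by (simp add: reduced_energy_def K_def r_def v_def)
    ultimately show "h \<xi> \<le> p \<xi>"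
      unfolding h_def by argo
  qed
  have h0: "h x = 0"
    by (simp add: h_def K_def w0_def reduced_energy_def)
  have p0: "p x = 0"
    by (simp add: p_def r0)
  have "(h has_derivative (\<lambda>_. 0)) (at x)"
    unfolding has_derivative_iff_norm
  proof
    have "((\<lambda>y. norm (p y - p x - 0) / norm (y - x)) \<longlongrightarrow> 0) (at x)"
      using p' unfolding has_derivative_iff_norm by blast
    then show "((\<lambda>y. norm (h y - h x - 0) / norm (y - x)) \<longlongrightarrow> 0) (at x)"
    proof (rule tendsto_sandwich[OF _ _ tendsto_const, rotated 2])
      show "\<forall>\<^sub>F y in at x. norm (h y - h x - 0) / norm (y - x) \<le> norm (p y - p x - 0) / norm (y - x)"
        using ev
      proof eventually_elim
        case (elim y)
        then show ?case
          using gap[of y] by (intro divide_right_mono) (auto simp: h0 p0)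
      qed
    qed simp
  qed simp
  moreover have "GDERIV (K w0) x :> grad (K w0) x"
    using diff by (simp add: K_def GDERIV_grad)
  ultimately have "((\<lambda>\<xi>. K w0 \<xi> - h \<xi>) has_derivative (\<lambda>v. v \<bullet> grad (K w0) x - 0)) (at x)"
    unfolding gderiv_def by (intro has_derivative_diff)
  then show ?thesis
    by (simp add: h_def gderiv_def K_def w0_def)
qed

end

theorem corollary1:
  fixes a :: "'u::{real_inner, complete_space} \<Rightarrow> 'u \<Rightarrow> real"
    and l :: "'u \<Rightarrow> real"
    and \<alpha> :: real
    and ustar :: 'u
    and X :: "(real ^ 'n) set"
    and \<phi> :: "real ^ 'n \<Rightarrow> 'u ^ 'l"
    and ip :: "real ^ 'n \<Rightarrow> real ^ 'n \<Rightarrow> real"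
    and \<psi> :: "real ^ 'n \<Rightarrow> real"
    and \<mu> \<omega>\<^sub>m\<^sub>i\<^sub>n \<rho> L \<zeta> :: real
    and w :: "nat \<Rightarrow> real ^ 'l"
    and \<xi> :: "nat \<Rightarrow> real ^ 'n"
    and n :: nat
  assumes a_bilinear: "bounded_bilinear a"
    and a_sym: "\<And>u v. a u v = a v u"
    and a_coercive: "\<alpha> > 0" "\<And>u. a u u \<ge> \<alpha> * (norm u)\<^sup>2"
    and l_linear: "bounded_linear l"
    and ustar: "\<And>v. a ustar v = l v"
    and X: "closed X" "X \<noteq> {}"
    and ip: "is_inner_product ip"
    and psi: "twice_differentiable_around \<psi> X" "\<mu> > 0" "strongly_convex_wrt ip \<mu> X \<psi>"
    and gram_bound: "\<omega>\<^sub>m\<^sub>i\<^sub>n > 0" "\<And>\<eta>. \<eta> \<in> X \<Longrightarrow> lambda_min (gram \<phi> \<eta>) \<ge> \<omega>\<^sub>m\<^sub>i\<^sub>n"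
    and X_convex_compact: "convex X" "compact X"
    and K_diff: "\<And>v. differentiable_around (param_energy a l \<phi> v) X"
    and dir_convex: "\<rho> > 0"
      "directionally_convex \<psi> (best_params a l \<phi> X) (reduced_energy a l \<phi>)
         (bregman_sublevel \<psi> (best_params a l \<phi> X) X \<rho>)"
    and grad_Lipschitz: "L > 0"
      "\<And>\<eta> \<theta>. \<eta> \<in> X \<Longrightarrow> \<theta> \<in> X \<Longrightarrow>
         ip_dual_norm ip (grad (reduced_energy a l \<phi>) \<eta> - grad (reduced_energy a l \<phi>) \<theta>)
           \<le> L * ip_norm ip (\<eta> - \<theta>)"
    and init: "\<xi> 0 \<in> bregman_sublevel \<psi> (best_params a l \<phi> X) X \<rho>"
    and zeta: "0 < \<zeta>" "\<zeta> \<le> 1"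
    and run: "exact_alternating_run a l \<phi> X \<psi> (\<lambda>k. \<zeta> * \<mu> / L) w \<xi>"
    and n: "n \<ge> 1"
  shows "(energy_norm a (reduced_realisation a l \<phi> (\<xi> n) - ustar))\<^sup>2
    \<le> (INF v \<in> trial_set \<phi> X. (energy_norm a (v - ustar))\<^sup>2)
      + 2 * L * bregman_dist \<psi> (best_params a l \<phi> X) (\<xi> 0) / (\<zeta> * \<mu> * real n)"
proof -
  interpret ritz_problem a l \<alpha>
    by (intro ritz_problem.intro ritz_problem_axioms.intro a_bilinear a_sym a_coercive l_linear)
  define f where "f = reduced_energy a l \<phi>"
  define S where "S = best_params a l \<phi> X"
  define m where "m = optimal_energy a l \<phi> X"
  define \<gamma> where "\<gamma> = \<zeta> * \<mu> / L"
  have \<gamma>: "0 < \<gamma>" "\<gamma> * L \<le> \<mu>"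
    using zeta psi(2) grad_Lipschitz(1) by (simp_all add: \<gamma>_def mult_le_cancel_right1)
  have f': "GDERIV f x :> grad (param_energy a l \<phi> (w_best a l \<phi> x)) x" if "x \<in> X" for x
    unfolding f_def
  proof (rule GDERIV_reduced_energy)
    show "param_energy a l \<phi> v differentiable (at x)" for v
      using K_diff that by (rule differentiable_around_imp_differentiable_at)
    show "0 < v \<bullet> (stiffness a \<phi> x *v v)" if "v \<noteq> 0" for v
      using gram_bound(1) gram_bound(2)[OF \<open>x \<in> X\<close>] that by (intro stiffness_positive) auto
  qed
  then have df: "GDERIV f x :> grad f x" if "x \<in> X" for x
    using f'[OF that] by (simp only: grad_eq[OF f'[OF that]])
  have d\<psi>: "GDERIV \<psi> x :> grad \<psi> x" if "x \<in> X" for x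
  proof (rule GDERIV_grad[OF differentiable_around_imp_differentiable_at[OF _ that]])
    show "differentiable_around \<psi> X"
      using psi(1) by (auto simp: differentiable_around_def twice_differentiable_around_def)
  qed
  have strong: "\<mu> / 2 * (ip_norm ip (y - x))\<^sup>2 \<le> bregman \<psi> y x" if "x \<in> X" "y \<in> X" for x y
    using psi(3) that by (fastforce simp: strongly_convex_wrt_def bregman_def)
  have smooth: "f y \<le> f x + grad f x \<bullet> (y - x) + bregman \<psi> y x / \<gamma>" if "x \<in> X" "y \<in> X" for x y
  proof -
    have "\<gamma> * L * (ip_norm ip (y - x))\<^sup>2 \<le> \<mu> * (ip_norm ip (y - x))\<^sup>2"
      using \<gamma>(2) by (intro mult_right_mono) auto
    with strong[OF that] \<gamma>(1) have "L / 2 * (ip_norm ip (y - x))\<^sup>2 \<le> bregman \<psi> y x / \<gamma>"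
      by (simp add: field_simps)
    moreover have "f y \<le> f x + grad f x \<bullet> (y - x) + L / 2 * (ip_norm ip (y - x))\<^sup>2"
      using grad_Lipschitz(2) that
      by (intro descent_lemma[OF ip X_convex_compact(1) df]) (auto simp: f_def)
    ultimately show ?thesis
      by linarith
  qed
  have error: "(energy_norm a (v - ustar))\<^sup>2 = 2 * (energy a l v - energy a l ustar)" for v
    using ustar by (rule energy_norm_diff_solution)
  have "energy a l ustar \<le> param_energy a l \<phi> v x" for v x
    using error[of "realisation \<phi> v x"] zero_le_power2[of "energy_norm a (realisation \<phi> v x - ustar)"]
    by (simp add: param_energy_def)
  then have "bdd_below ((\<lambda>(v, x). param_energy a l \<phi> v x) ` (UNIV \<times> X))"
    by (intro bdd_belowI2[where m = "energy a l ustar"]) auto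
  then have m_le: "m \<le> param_energy a l \<phi> v x" if "x \<in> X" for v x
    unfolding m_def optimal_energy_def using cINF_lower that by fastforce
  have "f (\<xi> n) - m \<le> bregman_dist \<psi> S (\<xi> 0) / (\<gamma> * real n)"
  proof (rule mirror_descent_rate[OF X_convex_compact(1) _ _ _ df d\<psi> _ \<gamma>(1) smooth _ _ _ n])
    show "S \<subseteq> X" and "\<And>x. x \<in> S \<Longrightarrow> f x = m"
      by (auto simp: S_def best_params_def f_def m_def)
    show "m \<le> f x" if "x \<in> X" for x
      using m_le[OF that] by (simp add: f_def reduced_energy_def)
    show "0 \<le> bregman \<psi> y x" if "x \<in> X" "y \<in> X" for x y
      using psi(2) by (intro order_trans[OF _ strong[OF that]]) simp
    show "directionally_convex \<psi> S f (bregman_sublevel \<psi> S X \<rho>)"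
      using dir_convex(2) by (simp add: S_def f_def)
    show "\<xi> 0 \<in> bregman_sublevel \<psi> S X \<rho>"
      using init by (simp add: S_def)
    have mem: "\<xi> k \<in> X" for k
      using init run
      by (cases k) (auto simp: bregman_sublevel_def exact_alternating_run_def is_arg_min_def)
    show "is_arg_min (\<lambda>\<eta>. \<gamma> * (grad f (\<xi> k) \<bullet> \<eta>) + bregman \<psi> \<eta> (\<xi> k))
      (\<lambda>\<eta>. \<eta> \<in> X) (\<xi> (Suc k))" for k
    proof -
      have "w k = w_best a l \<phi> (\<xi> k)"
        using run by (simp add: exact_alternating_run_def)
      then have "grad f (\<xi> k) = grad (param_energy a l \<phi> (w k)) (\<xi> k)"
        using grad_eq[OF f'[OF mem[of k]]] by simp
      then show ?thesis
        using run unfolding exact_alternating_run_def \<gamma>_def by metis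
    qed
  qed
  moreover have "2 * (m - energy a l ustar) \<le> (INF v \<in> trial_set \<phi> X. (energy_norm a (v - ustar))\<^sup>2)"
  proof (rule cINF_greatest)
    show "trial_set \<phi> X \<noteq> {}"
      using X(2) by (auto simp: trial_set_def)
    show "2 * (m - energy a l ustar) \<le> (energy_norm a (v - ustar))\<^sup>2" if "v \<in> trial_set \<phi> X" for v
      using that m_le by (auto simp: trial_set_def error param_energy_def)
  qed
  moreover have "(energy_norm a (reduced_realisation a l \<phi> (\<xi> n) - ustar))\<^sup>2 = 2 * (f (\<xi> n) - energy a l ustar)"
    by (simp add: error f_def reduced_energy_def reduced_realisation_def param_energy_def)
  moreover have rate: "2 * L * bregman_dist \<psi> (best_params a l \<phi> X) (\<xi> 0) / (\<zeta> * \<mu> * real n)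
      = 2 * (bregman_dist \<psi> S (\<xi> 0) / (\<gamma> * real n))"
    by (simp add: \<gamma>_def S_def)
  ultimately show ?thesis
    unfolding rate by argo
qed

end
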